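(* Let $r\geq2$ be an integer, let $-\pi<\phi<\pi$, and let $a,w_1,\ldots,w_r\in\mathcal{H}_{\phi}$ be fixed; put $\boldsymbol{w}=(w_1,\ldots,w_r)$. Let $R_q$ $(1\le q\le r)$ be the residue of the Barnes multiple zeta function $\zeta_r(s,a;\boldsymbol{w})$ at $s=q$, and let $E_r(s)$ be the entire function obtained from $\zeta_r(s,a;\boldsymbol w)-\sum_{q=1}^r\frac{R_q}{s-q}$ by removing the removable singularities at $s=1,\ldots,r$. Then for $j\in\{1,\ldots,r\}$ and every integer $k\geq0$, \[ \gamma_k(j,a;\boldsymbol w)=(-1)^k\sum_{q=1}^{j-1}\frac{R_q}{(j-q)^{k+1}}-\sum_{q=j+1}^r\frac{R_q}{(q-j)^{k+1}}+\frac{E_r^{(k)}(j)}{k!}. \] For every $R>0$, let $M_{j,R}:=\max_{|s-j|=R}|E_r(s)|$. Then \[ \left|\gamma_k(j,a;\boldsymbol w)-(-1)^k\sum_{q=1}^{j-1}\frac{R_q}{(j-q)^{k+1}}+\sum_{q=j+1}^r\frac{R_q}{(q-j)^{k+1}}\right|\leq\frac{M_{j,R}}{R^k}. \] Empty sums are understood to be zero.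
   Context: For a fixed real number $-\pi<\phi<\pi$, $\mathcal{H}_{\phi}=\{\rho e^{i\theta}\in\mathbb{C}: \rho>0,\ \phi-\frac{\pi}{2}<\theta<\phi+\frac{\pi}{2}\}$ is an open half-plane. A fixed, otherwise arbitrary, holomorphic logarithm $\log$ on $\mathcal{H}_{\phi}$ is used throughout, with $z^s=\exp(s\log z)$ for $z\in\mathcal{H}_{\phi}$, $s\in\mathbb{C}$. For $a,w_1,\ldots,w_r\in\mathcal{H}_{\phi}$, the Barnes multiple zeta function is \[ \zeta_r(s,a;\boldsymbol{w})=\sum_{m_1=0}^{\infty}\cdots\sum_{m_r=0}^{\infty}(a+m_1w_1+\cdots+m_rw_r)^{-s}, \] which converges absolutely for $\operatorname{Re}s>r$ and continues meromorphically to all $s\in\mathbb{C}$, with only possible singularities simple poles at $s=1,\ldots,r$; the symbol $\zeta_r$ denotes the continued function. Its residues are $R_q=\operatorname{Res}_{s=q}\zeta_r(s,a;\boldsymbol w)$, $1\le q\le r$ (possibly zero). The Laurent coefficients at $s=j$ ($1\le j\le r$) are defined by \[ \zeta_r(s,a;\boldsymbol{w})=\frac{R_j}{s-j}+\sum_{k=0}^\infty\gamma_k(j,a;\boldsymbol{w})(s-j)^k \] for $s$ near $j$, $s\neq j$. *)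

theory Defs
  imports "HOL-Complex_Analysis.Complex_Analysis"
begin

definition half_plane :: "real \<Rightarrow> complex set" where
  "half_plane \<phi> =
     {of_real \<rho> * exp (\<i> * of_real \<theta>) | \<rho> \<theta>. \<rho> > 0 \<and> \<phi> - pi / 2 < \<theta> \<and> \<theta> < \<phi> + pi / 2}"

definition holomorphic_log_on :: "(complex \<Rightarrow> complex) \<Rightarrow> complex set \<Rightarrow> bool" where
  "holomorphic_log_on lg A \<longleftrightarrow> lg holomorphic_on A \<and> (\<forall>z\<in>A. exp (lg z) = z)"

text \<open>
  In the following, the parameter vector \<open>(w\<^sub>1, \<dots>, w\<^sub>r)\<close> is represented by a function \<open>w\<close> of which
  only the values at \<open>1, \<dots>, r\<close> matter, and \<open>lg\<close> is the chosen logarithm, so that \<open>z\<^sup>s\<close> is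
  \<open>exp (s * lg z)\<close>. The \<open>r\<close>-fold series is absolutely convergent for \<open>Re s > r\<close> and is written as an
  unordered sum over all multi-indices \<open>(m\<^sub>1, \<dots>, m\<^sub>r)\<close>.
\<close>

definition barnes_series ::
  "(complex \<Rightarrow> complex) \<Rightarrow> nat \<Rightarrow> complex \<Rightarrow> (nat \<Rightarrow> complex) \<Rightarrow> complex \<Rightarrow> complex" where
  "barnes_series lg r a w s =
     (\<Sum>\<^sub>\<infinity>m\<in>{1..r} \<rightarrow>\<^sub>E (UNIV :: nat set). exp (- s * lg (a + (\<Sum>i=1..r. of_nat (m i) * w i))))"

text \<open>
  The meromorphic continuation to the whole plane. A ``nicely'' meromorphic function has no
  spurious removable singularities and takes the value \<open>0\<close> at its poles, which pins down the
  continuation uniquely as a total function.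
\<close>

definition barnes_zeta ::
  "(complex \<Rightarrow> complex) \<Rightarrow> nat \<Rightarrow> complex \<Rightarrow> (nat \<Rightarrow> complex) \<Rightarrow> complex \<Rightarrow> complex" where
  "barnes_zeta lg r a w =
     (THE Z. Z nicely_meromorphic_on UNIV \<and> (\<forall>s. Re s > of_nat r \<longrightarrow> Z s = barnes_series lg r a w s))"

definition barnes_residue ::
  "(complex \<Rightarrow> complex) \<Rightarrow> nat \<Rightarrow> complex \<Rightarrow> (nat \<Rightarrow> complex) \<Rightarrow> nat \<Rightarrow> complex" where
  "barnes_residue lg r a w q = residue (barnes_zeta lg r a w) (of_nat q)"

definition barnes_gamma ::
  "(complex \<Rightarrow> complex) \<Rightarrow> nat \<Rightarrow> complex \<Rightarrow> (nat \<Rightarrow> complex) \<Rightarrow> nat \<Rightarrow> nat \<Rightarrow> complex" where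
  "barnes_gamma lg r a w k j =
     fls_nth (laurent_expansion (barnes_zeta lg r a w) (of_nat j)) (int k)"

definition barnes_entire ::
  "(complex \<Rightarrow> complex) \<Rightarrow> nat \<Rightarrow> complex \<Rightarrow> (nat \<Rightarrow> complex) \<Rightarrow> complex \<Rightarrow> complex" where
  "barnes_entire lg r a w =
     remove_sings (\<lambda>s. barnes_zeta lg r a w s
                       - (\<Sum>q=1..r. barnes_residue lg r a w q / (s - of_nat q)))"

text \<open>
  The maximum is taken over an infinite set, for which \<^const>\<open>Max\<close> is unspecified; hence
  \<^const>\<open>Greatest\<close>.
\<close>

definition max_norm_on_circle :: "(complex \<Rightarrow> complex) \<Rightarrow> complex \<Rightarrow> real \<Rightarrow> real" where
  "max_norm_on_circle f c R = (GREATEST x. x \<in> (\<lambda>s. norm (f s)) ` sphere c R)"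

end

theory Submission
  imports Defs
begin

text \<open>
  Once it is known that the Barnes zeta function \<open>\<zeta>\<close> is an entire function \<open>E\<close> plus a sum of simple
  poles \<open>R\<^sub>q / (s - q)\<close>, \<open>1 \<le> q \<le> r\<close>, the statement is a computation: \<open>E\<close> is then \<open>E\<^sub>r\<close>, the
  regular part of \<open>\<zeta>\<close> at \<open>j\<close> consists of the Taylor series of \<open>E\<close> and of the geometric series of
  the fractions with \<open>q \<noteq> j\<close>, and the estimate is Cauchy's inequality for \<open>E\<close>. The substance lies in
  the meromorphic continuation, which the definition of \<open>\<zeta>\<close> as a definite description presupposes.

  The continuation is obtained from the series alone, by comparing it with its shift. Let
  \<open>\<zeta>\<^sub>r(s)\<close> be the series with \<open>r\<close> periods and \<open>w\<close> one of them. Removing the terms in which \<open>w\<close>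
  does not occur replaces \<open>a\<close> by \<open>a + w\<close> and changes the sum by the series \<open>\<zeta>\<^sub>r\<^sub>-\<^sub>1(s)\<close> without \<open>w\<close>
  (\<open>barnes_sum_split\<close>). On the other hand, \<open>(z + w)\<^sup>-\<^sup>s\<close> can be expanded in powers of \<open>w\<close>, which gives
  the values \<open>\<zeta>\<^sub>r(s + k)\<close> with binomial coefficients of \<open>- s\<close>, up to order \<open>K\<close>. Altogether
  (\<open>barnes_sum_recurrence\<close>), \<open>s w \<zeta>\<^sub>r(s + 1)\<close> is the sum of \<open>\<zeta>\<^sub>r\<^sub>-\<^sub>1(s)\<close>, of multiples of
  \<open>\<zeta>\<^sub>r(s + 2), \<dots>, \<zeta>\<^sub>r(s + K)\<close>, and of a series of Taylor remainders. The remainders decay so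
  fast that their series converges for \<open>Re s > r - K - 1\<close> (\<open>remainder_sum_holomorphic\<close>).

  The recurrence therefore computes \<open>\<zeta>\<^sub>r\<close> from its values farther to the right and extends it by one
  unit to the left at a time. To avoid any bookkeeping of poles, it is applied to
  \<open>(s - 1) \<dots> (s - r) \<zeta>\<^sub>r(s)\<close>, for which it turns out to have holomorphic coefficients
  (\<open>continuation_step\<close>); so this product extends to an entire function
  (\<open>barnes_sum_continuation\<close>). Division by the polynomial and \<open>partial_fractions\<close> then give the
  required shape of \<open>\<zeta>\<close> (\<open>barnes_zeta_simple_poles\<close>).
\<close>

section \<open>The half-plane and powers defined by its logarithm\<close>

text \<open>
  The coordinate along the axis \<open>exp (\<i> \<phi>)\<close> of the half-plane. It is additive and bounded by the
  norm, so lower bounds for the norms of the points \<open>a + \<Sum> m\<^sub>i w\<^sub>i\<close> can be read off from a linear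
  function of the \<open>m\<^sub>i\<close>.
\<close>
definition height :: "real \<Rightarrow> complex \<Rightarrow> real" where
  "height \<phi> z = Re (cis (- \<phi>) * z)"

lemma height_add: "height \<phi> (y + z) = height \<phi> y + height \<phi> z"
  by (simp add: height_def algebra_simps)

lemma height_scale: "height \<phi> (of_real t * z) = t * height \<phi> z"
  by (simp add: height_def algebra_simps)

lemma height_of_nat: "height \<phi> (of_nat n * z) = real n * height \<phi> z"
  using height_scale[of \<phi> "real n" z] by simp

lemma height_sum: "height \<phi> (\<Sum>i\<in>I. f i) = (\<Sum>i\<in>I. height \<phi> (f i))"
  by (induction I rule: infinite_finite_induct) (auto simp: height_add, simp_all add: height_def)

lemma height_le_norm: "height \<phi> z \<le> norm z"
  unfolding height_def by (rule order_trans[OF complex_Re_le_cmod]) (simp add: norm_mult)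

lemma half_plane_eq_height: "half_plane \<phi> = {z. height \<phi> z > 0}"
proof (intro equalityI subsetI)
  fix z assume "z \<in> half_plane \<phi>"
  then obtain \<rho> \<theta> where z: "z = of_real \<rho> * exp (\<i> * of_real \<theta>)"
    and "\<rho> > 0" and \<theta>: "\<phi> - pi / 2 < \<theta>" "\<theta> < \<phi> + pi / 2"
    unfolding half_plane_def by blast
  have "cis (- \<phi>) * z = of_real \<rho> * cis (\<theta> - \<phi>)"
    by (simp add: z cis_conv_exp mult_exp_exp algebra_simps)
  then have "height \<phi> z = \<rho> * cos (\<theta> - \<phi>)"
    unfolding height_def by (simp only: Re_complex_of_real times_complex.sel) simp
  moreover have "cos (\<theta> - \<phi>) > 0"
    using \<theta> by (intro cos_gt_zero_pi) auto
  ultimately show "z \<in> {z. height \<phi> z > 0}"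
    using \<open>\<rho> > 0\<close> by simp
next
  fix z assume "z \<in> {z. height \<phi> z > 0}"
  then have h: "Re (cis (- \<phi>) * z) > 0"
    by (simp add: height_def)
  define y where "y = cis (- \<phi>) * z"
  have y0: "y \<noteq> 0" "Re y > 0"
    using h by (auto simp: y_def)
  have "z = cis \<phi> * y"
    by (simp add: y_def mult.assoc[symmetric] cis_mult)
  also have "y = of_real (norm y) * cis (Arg y)"
    using y0 by (metis rcis_cmod_Arg rcis_def)
  finally have "z = of_real (norm y) * exp (\<i> * of_real (\<phi> + Arg y))"
    by (simp add: cis_conv_exp mult_exp_exp algebra_simps)
  moreover have "\<bar>Arg y\<bar> < pi / 2"
    using y0 Arg_Re_pos by blast
  ultimately show "z \<in> half_plane \<phi>"
    using y0 unfolding half_plane_def by (intro CollectI exI[of _ "norm y"] exI[of _ "\<phi> + Arg y"]) auto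
qed

lemma open_half_plane: "open (half_plane \<phi>)"
  unfolding half_plane_eq_height height_def by (intro open_Collect_less continuous_intros)

lemma convex_half_plane: "convex (half_plane \<phi>)"
proof -
  have "half_plane \<phi> = {z. cis \<phi> \<bullet> z > 0}"
    by (simp add: half_plane_eq_height height_def inner_complex_def)
  then show ?thesis
    by (simp add: convex_halfspace_gt)
qed

locale half_plane_log =
  fixes \<phi> :: real and lg :: "complex \<Rightarrow> complex"
  assumes log: "holomorphic_log_on lg (half_plane \<phi>)"
begin

abbreviation H :: "complex set" where "H \<equiv> half_plane \<phi>"

lemma zero_notin_H: "z \<in> H \<Longrightarrow> z \<noteq> 0"
  by (auto simp: half_plane_eq_height height_def)

lemma exp_lg: "z \<in> H \<Longrightarrow> exp (lg z) = z"
  using log by (simp add: holomorphic_log_on_def)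

lemma lg_has_field_derivative:
  assumes "z \<in> H"
  shows "(lg has_field_derivative inverse z) (at z)"
proof -
  have "lg holomorphic_on H"
    using log by (simp add: holomorphic_log_on_def)
  then obtain D where D: "(lg has_field_derivative D) (at z)"
    using assms open_half_plane holomorphic_on_imp_differentiable_at field_differentiable_def by blast
  have "((\<lambda>x. exp (lg x)) has_field_derivative exp (lg z) * D) (at z)"
    by (rule DERIV_fun_exp) (rule D)
  then have "((\<lambda>x. x) has_field_derivative exp (lg z) * D) (at z)"
    by (rule has_field_derivative_transform_within_open) (use assms open_half_plane exp_lg in auto)
  then have "z * D = 1"
    using DERIV_unique[OF _ DERIV_ident] exp_lg[OF assms] by auto
  then show ?thesis
    using D by (simp add: inverse_unique)
qed

lemma Re_lg:
  assumes "z \<in> H" shows "Re (lg z) = ln (norm z)"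
  by (metis assms exp_lg ln_exp norm_exp_eq_Re)

text \<open>
  Two holomorphic logarithms on a connected set differ by a constant, and the principal logarithm
  after rotating the half-plane to the right one has imaginary part between \<open>- \<pi>\<close> and \<open>\<pi>\<close>.
\<close>
lemma bounded_Im_lg: "\<exists>B\<ge>0. \<forall>z\<in>H. \<bar>Im (lg z)\<bar> \<le> B"
proof -
  have "\<exists>C. \<forall>z\<in>H. lg z - Ln (cis (- \<phi>) * z) = C"
  proof (rule has_field_derivative_zero_constant[OF convex_half_plane])
    fix z assume z: "z \<in> H"
    then have "cis (- \<phi>) * z \<notin> \<real>\<^sub>\<le>\<^sub>0"
      by (auto simp: half_plane_eq_height height_def complex_nonpos_Reals_iff)
    then have "((\<lambda>z. lg z - Ln (cis (- \<phi>) * z)) has_field_derivative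
        inverse z - inverse (cis (- \<phi>) * z) * cis (- \<phi>)) (at z)"
      using z zero_notin_H[OF z] by (auto intro!: derivative_eq_intros lg_has_field_derivative simp: field_simps)
    then show "((\<lambda>z. lg z - Ln (cis (- \<phi>) * z)) has_field_derivative 0) (at z within H)"
      using has_field_derivative_at_within by (fastforce simp: field_simps)
  qed
  then obtain C where C: "\<And>z. z \<in> H \<Longrightarrow> lg z = C + Ln (cis (- \<phi>) * z)"
    by (auto simp: algebra_simps)
  have "\<bar>Im (lg z)\<bar> \<le> \<bar>Im C\<bar> + pi" if "z \<in> H" for z
  proof -
    have "cis (- \<phi>) * z \<noteq> 0"
      using zero_notin_H[OF that] by simp
    then have "\<bar>Im (Ln (cis (- \<phi>) * z))\<bar> \<le> pi"
      using Im_Ln_le_pi mpi_less_Im_Ln by (metis abs_le_iff less_imp_le minus_le_iff)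
    then show ?thesis
      using C[OF that] by simp
  qed
  moreover have "\<bar>Im C\<bar> + pi \<ge> 0" using pi_ge_zero by linarith
  ultimately show ?thesis by blast
qed

text \<open>
  Fixing one bound for the argument lets the estimates below be stated with an explicit constant.
\<close>
definition arg_bound :: real where "arg_bound = (SOME B. B \<ge> 0 \<and> (\<forall>z\<in>H. \<bar>Im (lg z)\<bar> \<le> B))"

lemma abs_Im_lg_le: "z \<in> H \<Longrightarrow> \<bar>Im (lg z)\<bar> \<le> arg_bound"
  using someI_ex[OF bounded_Im_lg] unfolding arg_bound_def by blast

text \<open>
  The modulus of \<open>z\<^sup>-\<^sup>s\<close> is \<open>\<bar>z\<bar> powr (- Re s)\<close> up to a factor bounded in terms of \<open>s\<close>. Having \<open>u\<close>
  instead of \<open>\<bar>z\<bar>\<close> on the right makes the bound uniform on all points above a given height, as needed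
  for Taylor's theorem on a segment.
\<close>
lemma norm_exp_lg_le:
  assumes u: "0 < u" "u \<le> height \<phi> z" and s: "Re s \<ge> 0"
  shows "norm (exp (- s * lg z)) \<le> exp (arg_bound * \<bar>Im s\<bar>) * u powr (- Re s)"
proof -
  have z: "z \<in> H" using u by (simp add: half_plane_eq_height)
  have uz: "u \<le> norm z" using u height_le_norm order_trans by blast
  have "norm (exp (- s * lg z)) = exp (- Re s * ln (norm z) + Im s * Im (lg z))"
    by (simp add: Re_lg[OF z])
  also have "\<dots> \<le> exp (- Re s * ln u + arg_bound * \<bar>Im s\<bar>)"
  proof -
    have "ln u \<le> ln (norm z)"
      using u uz by (intro ln_mono) auto
    then have "Re s * ln u \<le> Re s * ln (norm z)"
      using s by (intro mult_left_mono)
    moreover have "Im s * Im (lg z) \<le> \<bar>Im s\<bar> * arg_bound"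
      using abs_Im_lg_le[OF z] by (metis abs_ge_self abs_ge_zero abs_mult mult_left_mono order_trans)
    ultimately show ?thesis by (simp add: mult.commute)
  qed
  also have "\<dots> = exp (arg_bound * \<bar>Im s\<bar>) * u powr (- Re s)"
    using u by (simp add: powr_def mult_exp_exp algebra_simps)
  finally show ?thesis .
qed

end

section \<open>Holomorphic series over multi-indices\<close>

abbreviation indices :: "'i set \<Rightarrow> ('i \<Rightarrow> nat) set" where
  "indices I \<equiv> I \<rightarrow>\<^sub>E (UNIV :: nat set)"

lemma indices_insert:
  "indices (insert x I) = (\<lambda>(k, m). m(x := k)) ` (UNIV \<times> indices I)"
  by (simp add: PiE_insert_eq)

lemma inj_on_indices_insert:
  assumes "x \<notin> I"
  shows "inj_on (\<lambda>(k, m). m(x := k)) (UNIV \<times> indices I)"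
  using inj_combinator[OF assms, of "\<lambda>_. UNIV"] .

lemma summable_on_prod_indices:
  fixes f :: "nat \<Rightarrow> real"
  assumes "finite I" and f: "f summable_on UNIV" and nonneg: "\<And>k. f k \<ge> 0"
  shows "(\<lambda>m. \<Prod>i\<in>I. f (m i)) summable_on indices I"
  using \<open>finite I\<close>
proof induction
  case empty
  then show ?case by simp
next
  case (insert x I)
  have eq: "(\<Prod>i\<in>insert x I. f ((m(x := k)) i)) = f k * (\<Prod>i\<in>I. f (m i))" for m k
    using insert.hyps by (auto intro!: prod.cong)
  have "(\<lambda>p. f (fst p) * (\<Prod>i\<in>I. f (snd p i))) summable_on (UNIV \<times> indices I)"
  proof (rule summable_on_SigmaI)
    fix k :: nat
    show "((\<lambda>m. f (fst (k, m)) * (\<Prod>i\<in>I. f (snd (k, m) i))) has_sum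
        f k * (\<Sum>\<^sub>\<infinity>m\<in>indices I. \<Prod>i\<in>I. f (m i))) (indices I)"
      using insert.IH by (auto intro!: has_sum_cmult_right has_sum_infsum)
  next
    show "(\<lambda>k. f k * (\<Sum>\<^sub>\<infinity>m\<in>indices I. \<Prod>i\<in>I. f (m i))) summable_on UNIV"
      using f by (rule summable_on_cmult_left)
  qed (auto intro!: mult_nonneg_nonneg prod_nonneg nonneg)
  then show ?case
    unfolding indices_insert summable_on_reindex[OF inj_on_indices_insert[OF insert.hyps(2)]]
    by (simp only: o_def case_prod_unfold eq)
qed

definition level :: "'i set \<Rightarrow> ('i \<Rightarrow> nat) \<Rightarrow> real" where
  "level I m = 1 + (\<Sum>i\<in>I. real (m i))"

lemma level_ge_1: "level I m \<ge> 1"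
  by (simp add: level_def sum_nonneg)

text \<open>
  Each factor \<open>1 + m\<^sub>i\<close> is at most the level, so the level to the power \<open>- \<sigma>\<close> is dominated by the
  product of the \<open>(1 + m\<^sub>i) powr (- \<sigma> / r)\<close> with \<open>r = card I\<close>; this product is summable
  coordinatewise because \<open>\<sigma> / r > 1\<close>.
\<close>
lemma level_powr_summable:
  assumes I: "finite I" and \<sigma>: "\<sigma> > real (card I)"
  shows "(\<lambda>m. level I m powr (- \<sigma>)) summable_on indices I"
proof (cases "I = {}")
  case True
  then show ?thesis by simp
next
  case False
  define r where "r = card I"
  have r: "r > 0" using I False by (simp add: r_def card_gt_0_iff)
  have "summable (\<lambda>k. real k powr (- (\<sigma> / r)))"
    using \<sigma> r by (subst summable_real_powr_iff) (simp add: r_def field_simps)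
  then have "summable (\<lambda>k. real (Suc k) powr (- (\<sigma> / r)))"
    by (subst summable_Suc_iff)
  then have "(\<lambda>k. real (Suc k) powr (- (\<sigma> / r))) summable_on UNIV"
    by (rule summable_nonneg_imp_summable_on) simp
  then have "(\<lambda>m. \<Prod>i\<in>I. real (Suc (m i)) powr (- (\<sigma> / r))) summable_on indices I"
    using I by (intro summable_on_prod_indices) auto
  then show ?thesis
  proof (rule summable_on_comparison_test)
    fix m :: "'a \<Rightarrow> nat"
    have "level I m powr (- \<sigma>) = (\<Prod>i\<in>I. level I m powr (- (\<sigma> / r)))"
      using r level_ge_1[of I m] by (simp add: r_def[symmetric] powr_power)
    also have "\<dots> \<le> (\<Prod>i\<in>I. real (Suc (m i)) powr (- (\<sigma> / r)))"
    proof (rule prod_mono, intro conjI)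
      fix i assume "i \<in> I"
      then have "real (m i) \<le> (\<Sum>i\<in>I. real (m i))"
        using I by (intro member_le_sum) auto
      then show "level I m powr (- (\<sigma> / r)) \<le> real (Suc (m i)) powr (- (\<sigma> / r))"
        using \<sigma> r by (intro powr_mono2') (auto simp: level_def)
    qed auto
    finally show "level I m powr (- \<sigma>) \<le> (\<Prod>i\<in>I. real (Suc (m i)) powr (- (\<sigma> / r)))" .
  qed auto
qed

abbreviation right_half_plane :: "real \<Rightarrow> complex set" where
  "right_half_plane \<alpha> \<equiv> {s. \<alpha> < Re s}"

lemma open_right_half_plane: "open (right_half_plane \<alpha>)"
  by (intro open_Collect_less continuous_intros)

lemma holomorphic_on_infsum:
  fixes f :: "'a \<Rightarrow> complex \<Rightarrow> complex"
  assumes S: "open S"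
    and hol: "\<And>m. m \<in> A \<Longrightarrow> f m holomorphic_on S"
    and bound: "\<And>z. z \<in> S \<Longrightarrow> \<exists>d>0. \<exists>M. cball z d \<subseteq> S \<and> M summable_on A \<and>
                  (\<forall>m\<in>A. \<forall>s\<in>cball z d. norm (f m s) \<le> M m)"
  shows "(\<lambda>s. \<Sum>\<^sub>\<infinity>m\<in>A. f m s) holomorphic_on S"
  unfolding holomorphic_on_open[OF S]
proof
  fix z assume "z \<in> S"
  then obtain d M where d: "d > 0" "cball z d \<subseteq> S" and M: "M summable_on A"
    and le: "\<And>m s. m \<in> A \<Longrightarrow> s \<in> cball z d \<Longrightarrow> norm (f m s) \<le> M m"
    using bound by meson
  have fin: "\<forall>\<^sub>F X in finite_subsets_at_top A.
      continuous_on (cball z d) (\<lambda>s. \<Sum>m\<in>X. f m s) \<and> (\<lambda>s. \<Sum>m\<in>X. f m s) holomorphic_on ball z d"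

  proof (rule eventually_finite_subsets_at_top_weakI)
    fix X assume "finite X" "X \<subseteq> A"
    then have "(\<lambda>s. \<Sum>m\<in>X. f m s) holomorphic_on S"
      using hol by (intro holomorphic_on_sum) auto
    then show "continuous_on (cball z d) (\<lambda>s. \<Sum>m\<in>X. f m s) \<and>
        (\<lambda>s. \<Sum>m\<in>X. f m s) holomorphic_on ball z d"
      using d(2) ball_subset_cball
      by (meson holomorphic_on_imp_continuous_on holomorphic_on_subset subset_trans)
  qed
  have "(\<lambda>s. \<Sum>\<^sub>\<infinity>m\<in>A. f m s) holomorphic_on ball z d"
    using holomorphic_uniform_limit[OF fin Weierstrass_m_test_general[OF le M]] by auto
  then show "\<exists>f'. ((\<lambda>s. \<Sum>\<^sub>\<infinity>m\<in>A. f m s) has_field_derivative f') (at z)"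
    using d(1) by (auto simp: holomorphic_on_open)
qed

text \<open>
  The common form of the two series met below: the Barnes series itself, with \<open>\<beta> = 0\<close>, and the
  series of its Taylor remainders, where the gain \<open>\<beta>\<close> pushes the abscissa of convergence to the left.
\<close>
lemma
  fixes f :: "'a \<Rightarrow> complex \<Rightarrow> complex" and n :: "'a \<Rightarrow> real"
  assumes hol: "\<And>m. m \<in> A \<Longrightarrow> f m holomorphic_on right_half_plane \<alpha>"
    and bound: "\<And>m s. m \<in> A \<Longrightarrow> Re s > \<alpha> \<Longrightarrow> norm (f m s) \<le> C s * n m powr (- (Re s + \<beta>))"
    and C: "continuous_on (right_half_plane \<alpha>) C"
    and n: "\<And>m. m \<in> A \<Longrightarrow> n m \<ge> 1"
    and summable: "\<And>\<sigma>. \<sigma> > \<alpha> \<Longrightarrow> (\<lambda>m. n m powr (- (\<sigma> + \<beta>))) summable_on A"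
  shows summable_on_of_powr_bound: "\<And>s. Re s > \<alpha> \<Longrightarrow> (\<lambda>m. f m s) summable_on A"
    and holomorphic_on_infsum_of_powr_bound:
      "(\<lambda>s. \<Sum>\<^sub>\<infinity>m\<in>A. f m s) holomorphic_on right_half_plane \<alpha>"
proof -
  fix s assume "Re s > \<alpha>"
  then have "(\<lambda>m. C s * n m powr (- (Re s + \<beta>))) summable_on A"
    using summable by (intro summable_on_cmult_right) auto
  then show "(\<lambda>m. f m s) summable_on A"
    by (rule abs_summable_summable[OF Infinite_Sum.abs_summable_on_comparison_test'])
      (use bound \<open>Re s > \<alpha>\<close> in auto)
next
  show "(\<lambda>s. \<Sum>\<^sub>\<infinity>m\<in>A. f m s) holomorphic_on right_half_plane \<alpha>"
  proof (rule holomorphic_on_infsum[OF open_right_half_plane hol])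
    fix z assume "z \<in> right_half_plane \<alpha>"
    \<comment> \<open>A disc that stays to the right of an abscissa \<open>\<sigma> > \<alpha>\<close>, where \<open>n m \<ge> 1\<close> makes the bound at
      \<open>\<sigma>\<close> the largest.\<close>
    define d where "d = (Re z - \<alpha>) / 2"
    define \<sigma> where "\<sigma> = Re z - d"
    have d: "d > 0" "\<sigma> > \<alpha>"
      using \<open>z \<in> _\<close> by (auto simp: d_def \<sigma>_def field_simps)
    have Re_ge: "Re s \<ge> \<sigma>" if "s \<in> cball z d" for s
      using that abs_Re_le_cmod[of "z - s"] by (auto simp: \<sigma>_def dist_norm)
    have sub: "cball z d \<subseteq> right_half_plane \<alpha>"
      using Re_ge d(2) by force
    have "compact (C ` cball z d)"
      using C sub by (intro compact_continuous_image) (auto intro: continuous_on_subset)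
    then have "bdd_above (C ` cball z d)"
      by (intro bounded_imp_bdd_above compact_imp_bounded)
    then obtain B where B: "\<And>s. s \<in> cball z d \<Longrightarrow> C s \<le> B"
      unfolding bdd_above_def by blast
    show "\<exists>d>0. \<exists>M. cball z d \<subseteq> right_half_plane \<alpha> \<and> M summable_on A \<and>
        (\<forall>m\<in>A. \<forall>s\<in>cball z d. norm (f m s) \<le> M m)"
    proof (intro exI[of _ d] conjI exI[of _ "\<lambda>m. max 0 B * n m powr (- (\<sigma> + \<beta>))"] ballI)
      show "(\<lambda>m. max 0 B * n m powr (- (\<sigma> + \<beta>))) summable_on A"
        using summable[OF d(2)] by (rule summable_on_cmult_right)
      fix m s assume ms: "m \<in> A" "s \<in> cball z d"
      have "norm (f m s) \<le> C s * n m powr (- (Re s + \<beta>))"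
        using ms sub by (intro bound) auto
      also have "\<dots> \<le> max 0 B * n m powr (- (\<sigma> + \<beta>))"
        using B[OF ms(2)] Re_ge[OF ms(2)] n[OF ms(1)] by (intro mult_mono powr_mono) auto
      finally show "norm (f m s) \<le> max 0 B * n m powr (- (\<sigma> + \<beta>))" .
    qed (use d sub in auto)
  qed
qed

section \<open>The Barnes series and its Taylor remainders\<close>

definition node :: "'i set \<Rightarrow> complex \<Rightarrow> ('i \<Rightarrow> complex) \<Rightarrow> ('i \<Rightarrow> nat) \<Rightarrow> complex" where
  "node I a w m = a + (\<Sum>i\<in>I. of_nat (m i) * w i)"

definition barnes_sum ::
  "(complex \<Rightarrow> complex) \<Rightarrow> 'i set \<Rightarrow> complex \<Rightarrow> ('i \<Rightarrow> complex) \<Rightarrow> complex \<Rightarrow> complex" where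
  "barnes_sum lg I a w s = (\<Sum>\<^sub>\<infinity>m\<in>indices I. exp (- s * lg (node I a w m)))"

lemma continuous_on_pochhammer:
  "continuous_on A (\<lambda>s :: complex. pochhammer s n)"
  unfolding pochhammer_prod by (intro continuous_intros)

lemma holomorphic_on_pochhammer [holomorphic_intros]:
  "f holomorphic_on A \<Longrightarrow> (\<lambda>s. pochhammer (f s) n) holomorphic_on A"
  unfolding pochhammer_prod by (intro holomorphic_intros)

context half_plane_log
begin

lemma exp_lg_has_field_derivative:
  assumes "z \<in> H"
  shows "((\<lambda>z. exp (- s * lg z)) has_field_derivative - s * exp (- (s + 1) * lg z)) (at z)"
proof -
  have "- (s + 1) * lg z = - s * lg z + - lg z"
    by (simp add: algebra_simps)
  then have "exp (- (s + 1) * lg z) = exp (- s * lg z) * inverse z"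
    using exp_lg[OF assms] by (simp only: exp_add exp_minus)
  then have eq: "- s * exp (- (s + 1) * lg z) = exp (- s * lg z) * (- s * inverse z)"
    by (simp only: mult_ac)
  show ?thesis
    unfolding eq by (intro DERIV_fun_exp DERIV_cmult lg_has_field_derivative assms)
qed

text \<open>
  What is left of the binomial series of \<open>(z + \<omega>)\<^sup>-\<^sup>s\<close> in powers of \<open>\<omega>\<close>; the number
  \<open>(-1) ^ k * pochhammer s k / fact k\<close> is the binomial coefficient of \<open>- s\<close> over \<open>k\<close>.
\<close>
definition taylor_remainder :: "nat \<Rightarrow> complex \<Rightarrow> complex \<Rightarrow> complex \<Rightarrow> complex" where
  "taylor_remainder K \<omega> z s = exp (- s * lg (z + \<omega>)) -
     (\<Sum>k\<le>K. (-1) ^ k * pochhammer s k / fact k * \<omega> ^ k * exp (- (s + of_nat k) * lg z))"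

text \<open>
  The segment from \<open>z\<close> to \<open>z + \<omega>\<close> does not go below the height of \<open>z\<close>, so the derivative of order
  \<open>K + 1\<close> is bounded there by the power \<open>- (Re s + K + 1)\<close> of that height. Compared
  with the bound for \<open>z\<^sup>-\<^sup>s\<close>, this gains \<open>K + 1\<close> powers of the height.
\<close>
lemma norm_taylor_remainder_le:
  assumes u: "0 < u" "u \<le> height \<phi> z" and \<omega>: "\<omega> \<in> H" and s: "Re s + real (Suc K) \<ge> 0"
  shows "norm (taylor_remainder K \<omega> z s) \<le>
    norm (pochhammer s (Suc K)) * exp (arg_bound * \<bar>Im s\<bar>) * norm \<omega> ^ Suc K / fact K
      * u powr (- (Re s + real (Suc K)))"
proof -
  define f where "f = (\<lambda>i z. (-1) ^ i * pochhammer s i * exp (- (s + of_nat i) * lg z))"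
  have seg: "u \<le> height \<phi> x" if "x \<in> closed_segment z (z + \<omega>)" for x
  proof -
    from that obtain t where t: "0 \<le> t" "x = z + of_real t * \<omega>"
      by (auto simp: closed_segment_def scaleR_conv_of_real algebra_simps)
    then show ?thesis
      using u(2) \<omega> by (simp add: height_add height_scale half_plane_eq_height add_increasing2)
  qed
  have "norm (f 0 (z + \<omega>) - (\<Sum>i\<le>K. f i z * (z + \<omega> - z) ^ i / fact i))
      \<le> norm (pochhammer s (Suc K)) * (exp (arg_bound * \<bar>Im s\<bar>) * u powr (- (Re s + real (Suc K))))
          * norm (z + \<omega> - z) ^ Suc K / fact K"
  proof (rule complex_Taylor[where S = "closed_segment z (z + \<omega>)"])
    fix i x assume "x \<in> closed_segment z (z + \<omega>)"
    then have "x \<in> H"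
      using seg u(1) by (force simp: half_plane_eq_height)
    have eq: "f (Suc i) x = (-1) ^ i * pochhammer s i *
        (- (s + of_nat i) * exp (- (s + of_nat i + 1) * lg x))"
    proof -
      have "s + of_nat (Suc i) = s + of_nat i + 1" by simp
      then show ?thesis
        unfolding f_def pochhammer_Suc power_Suc by (simp only: mult_minus_left mult_minus_right mult_1 mult_ac)
    qed
    have "(f i has_field_derivative f (Suc i) x) (at x)"
      unfolding eq unfolding f_def
      by (rule DERIV_cmult[OF exp_lg_has_field_derivative[OF \<open>x \<in> H\<close>]])
    then show "(f i has_field_derivative f (Suc i) x) (at x within closed_segment z (z + \<omega>))"
      by (rule has_field_derivative_at_within)
  next
    fix x assume x: "x \<in> closed_segment z (z + \<omega>)"
    have "norm (exp (- (s + of_nat (Suc K)) * lg x))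
        \<le> exp (arg_bound * \<bar>Im (s + of_nat (Suc K))\<bar>) * u powr (- Re (s + of_nat (Suc K)))"
      using s by (intro norm_exp_lg_le u(1) seg x) simp
    then show "norm (f (Suc K) x) \<le>
        norm (pochhammer s (Suc K)) * (exp (arg_bound * \<bar>Im s\<bar>) * u powr (- (Re s + real (Suc K))))"
      unfolding f_def norm_mult norm_power by (intro mult_mono) (simp_all add: mult_left_mono)
  qed auto
  moreover have "f 0 (z + \<omega>) - (\<Sum>i\<le>K. f i z * (z + \<omega> - z) ^ i / fact i) = taylor_remainder K \<omega> z s"
    by (simp add: f_def taylor_remainder_def mult_ac)
  ultimately show ?thesis
    by (simp only: add_diff_cancel_left' mult_ac times_divide_eq_left times_divide_eq_right)
qed

end

locale barnes = half_plane_log \<phi> lg for \<phi> lg +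
  fixes I :: "'i set" and a :: complex and w :: "'i \<Rightarrow> complex"
  assumes finite_I: "finite I" and a_in_H: "a \<in> half_plane \<phi>"
    and w_in_H: "\<And>i. i \<in> I \<Longrightarrow> w i \<in> half_plane \<phi>"
begin

lemma height_node_bound: "\<exists>c>0. \<forall>m. c * level I m \<le> height \<phi> (node I a w m)"
proof -
  define c where "c = Min (insert (height \<phi> a) ((\<lambda>i. height \<phi> (w i)) ` I))"
  have c: "c \<le> height \<phi> a" "\<And>i. i \<in> I \<Longrightarrow> c \<le> height \<phi> (w i)"
    unfolding c_def using finite_I by auto
  have "c > 0"
    unfolding c_def using finite_I a_in_H w_in_H by (subst Min_gr_iff) (auto simp: half_plane_eq_height)
  moreover have "c * level I m \<le> height \<phi> (node I a w m)" for m
  proof -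
    have "c * level I m = c + (\<Sum>i\<in>I. real (m i) * c)"
      by (simp add: level_def distrib_left sum_distrib_left mult.commute)
    also have "\<dots> \<le> height \<phi> a + (\<Sum>i\<in>I. real (m i) * height \<phi> (w i))"
      using c by (intro add_mono sum_mono mult_left_mono) auto
    also have "\<dots> = height \<phi> (node I a w m)"
      by (simp add: node_def height_add height_sum height_of_nat)
    finally show ?thesis .
  qed
  ultimately show ?thesis by blast
qed

lemma
  shows barnes_sum_summable:
      "Re s > card I \<Longrightarrow> (\<lambda>m. exp (- s * lg (node I a w m))) summable_on indices I"
    and barnes_sum_holomorphic:
      "barnes_sum lg I a w holomorphic_on right_half_plane (card I)"
proof -
  obtain c where c: "c > 0" "\<And>m. c * level I m \<le> height \<phi> (node I a w m)"
    using height_node_bound by blast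
  define C where "C = (\<lambda>s. exp (arg_bound * \<bar>Im s\<bar>) * c powr (- Re s))"
  have cont: "continuous_on (right_half_plane (card I)) C"
    unfolding C_def using c(1) by (intro continuous_intros) auto
  have bound: "norm (exp (- s * lg (node I a w m))) \<le> C s * level I m powr (- (Re s + 0))"
    if "Re s > card I" for s m
    using norm_exp_lg_le[of "c * level I m" "node I a w m" s] c level_ge_1[of I m] that
    by (simp add: C_def powr_mult)
  have hol: "(\<lambda>s. exp (- s * lg (node I a w m))) holomorphic_on right_half_plane (card I)" for m
    by (intro holomorphic_intros)
  have sum: "(\<lambda>m. level I m powr (- (\<sigma> + 0))) summable_on indices I" if "\<sigma> > real (card I)" for \<sigma>
    using level_powr_summable[OF finite_I that] by simp
  show "Re s > card I \<Longrightarrow> (\<lambda>m. exp (- s * lg (node I a w m))) summable_on indices I"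
    by (rule summable_on_of_powr_bound[OF hol bound cont level_ge_1 sum])
  have "(\<lambda>s. \<Sum>\<^sub>\<infinity>m\<in>indices I. exp (- s * lg (node I a w m))) holomorphic_on right_half_plane (card I)"
    by (rule holomorphic_on_infsum_of_powr_bound[OF hol bound cont level_ge_1 sum])
  then show "barnes_sum lg I a w holomorphic_on right_half_plane (card I)"
    by (simp add: barnes_sum_def[abs_def])
qed

definition remainder_sum :: "nat \<Rightarrow> complex \<Rightarrow> complex \<Rightarrow> complex" where
  "remainder_sum K \<omega> s = (\<Sum>\<^sub>\<infinity>m\<in>indices I. taylor_remainder K \<omega> (node I a w m) s)"

text \<open>
  The faster decay of the remainders is what creates the continuation: their sum lives on a half-plane
  that is \<open>K + 1\<close> units wider than the half-plane of convergence of the Barnes series.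
\<close>
lemma
  assumes \<omega>: "\<omega> \<in> H"
  shows remainder_sum_summable:
      "Re s > real (card I) - real (Suc K) \<Longrightarrow>
         (\<lambda>m. taylor_remainder K \<omega> (node I a w m) s) summable_on indices I"
    and remainder_sum_holomorphic:
      "remainder_sum K \<omega> holomorphic_on right_half_plane (real (card I) - real (Suc K))"
proof -
  define \<alpha> where "\<alpha> = real (card I) - real (Suc K)"
  obtain c where c: "c > 0" "\<And>m. c * level I m \<le> height \<phi> (node I a w m)"
    using height_node_bound by blast
  define C where "C = (\<lambda>s. norm (pochhammer s (Suc K)) * exp (arg_bound * \<bar>Im s\<bar>) *
    norm \<omega> ^ Suc K / fact K * c powr (- (Re s + real (Suc K))))"
  have cont: "continuous_on (right_half_plane \<alpha>) C"
    unfolding C_def using c(1) by (intro continuous_intros continuous_on_pochhammer) auto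
  have bound: "norm (taylor_remainder K \<omega> (node I a w m) s)
      \<le> C s * level I m powr (- (Re s + real (Suc K)))"
    if "Re s > \<alpha>" for s m
  proof -
    have "Re s + real (Suc K) \<ge> 0" using that by (simp add: \<alpha>_def)
    moreover have "0 < c * level I m"
      using c(1) level_ge_1[of I m] by simp
    ultimately have *: "norm (taylor_remainder K \<omega> (node I a w m) s) \<le>
        norm (pochhammer s (Suc K)) * exp (arg_bound * \<bar>Im s\<bar>) * norm \<omega> ^ Suc K / fact K
          * (c * level I m) powr (- (Re s + real (Suc K)))"
      using norm_taylor_remainder_le[OF _ c(2) \<omega>] by blast
    note *
    also have "(c * level I m) powr (- (Re s + real (Suc K))) =
        c powr (- (Re s + real (Suc K))) * level I m powr (- (Re s + real (Suc K)))"
      by (rule powr_mult)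
    finally show ?thesis
      unfolding C_def by (simp only: mult.assoc)
  qed
  have hol: "(\<lambda>s. taylor_remainder K \<omega> (node I a w m) s) holomorphic_on right_half_plane \<alpha>" for m
    unfolding taylor_remainder_def by (intro holomorphic_intros) auto
  have sum: "(\<lambda>m. level I m powr (- (\<sigma> + real (Suc K)))) summable_on indices I" if "\<sigma> > \<alpha>" for \<sigma>
    using that by (intro level_powr_summable[OF finite_I]) (simp add: \<alpha>_def)
  show "Re s > real (card I) - real (Suc K) \<Longrightarrow>
         (\<lambda>m. taylor_remainder K \<omega> (node I a w m) s) summable_on indices I"
    unfolding \<alpha>_def[symmetric]
    by (rule summable_on_of_powr_bound[OF hol bound cont level_ge_1 sum])
  have "(\<lambda>s. \<Sum>\<^sub>\<infinity>m\<in>indices I. taylor_remainder K \<omega> (node I a w m) s) holomorphic_on right_half_plane \<alpha>"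
    by (rule holomorphic_on_infsum_of_powr_bound[OF hol bound cont level_ge_1 sum])
  then show "remainder_sum K \<omega> holomorphic_on right_half_plane (real (card I) - real (Suc K))"
    by (simp add: remainder_sum_def[abs_def] \<alpha>_def)
qed

end

section \<open>A recurrence for the Barnes series\<close>

lemma has_sum_sum_finite:
  fixes f :: "'k \<Rightarrow> 'a \<Rightarrow> 'b :: topological_comm_monoid_add"
  assumes "finite F" "\<And>k. k \<in> F \<Longrightarrow> (f k has_sum S k) A"
  shows "((\<lambda>m. \<Sum>k\<in>F. f k m) has_sum (\<Sum>k\<in>F. S k)) A"
  using assms
proof (induction F rule: finite_induct)
  case empty
  then show ?case by simp
next
  case (insert x F)
  then show ?case by (simp add: has_sum_add)
qed

lemma node_insert_0:
  assumes "x \<notin> J"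
  shows "node (insert x J) a w (m(x := 0)) = node J a w m"
proof (cases "finite J")
  case True
  have "(\<Sum>i\<in>J. of_nat ((m(x := 0)) i) * w i) = (\<Sum>i\<in>J. of_nat (m i) * w i)"
    using assms by (intro sum.cong) auto
  then show ?thesis
    using assms True by (simp add: node_def)
qed (simp add: node_def)

lemma node_Suc:
  assumes "finite I" "x \<in> I"
  shows "node I a w (m(x := Suc (m x))) = node I a w m + w x"
proof -
  have "(\<Sum>i\<in>I - {x}. of_nat ((m(x := Suc (m x))) i) * w i) = (\<Sum>i\<in>I - {x}. of_nat (m i) * w i)"
    by (intro sum.cong) auto
  then show ?thesis
    using assms by (simp add: node_def sum.remove algebra_simps)
qed

lemma indices_insert_Un:
  assumes "x \<notin> J"
  shows "indices (insert x J) =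
    (\<lambda>m. m(x := 0)) ` indices J \<union> (\<lambda>m. m(x := Suc (m x))) ` indices (insert x J)"
proof (intro equalityI subsetI)
  fix m assume m: "m \<in> indices (insert x J)"
  show "m \<in> (\<lambda>m. m(x := 0)) ` indices J \<union> (\<lambda>m. m(x := Suc (m x))) ` indices (insert x J)"
  proof (cases "m x")
    case 0
    have "m = (m(x := undefined))(x := 0)" using 0 by auto
    moreover have "m(x := undefined) \<in> indices J"
      using m assms by (auto simp: PiE_def extensional_def)
    ultimately show ?thesis by blast
  next
    case (Suc k)
    have "m = (m(x := k))(x := Suc ((m(x := k)) x))" using Suc by auto
    moreover have "m(x := k) \<in> indices (insert x J)"
      using m by (auto simp: PiE_def extensional_def)
    ultimately show ?thesis by blast
  qed
qed (auto simp: PiE_def extensional_def)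

context barnes
begin

text \<open>
  The terms with \<open>m x = 0\<close> form the Barnes series without \<open>w x\<close>; lowering \<open>m x\<close> by one in the other
  terms gives the full series with \<open>a\<close> moved to \<open>a + w x\<close>.
\<close>
lemma barnes_sum_split:
  assumes I: "I = insert x J" "x \<notin> J" and s: "Re s > card I"
  shows "barnes_sum lg I a w s =
    barnes_sum lg J a w s + (\<Sum>\<^sub>\<infinity>m\<in>indices I. exp (- s * lg (node I a w m + w x)))"
proof -
  define f where "f = (\<lambda>m. exp (- s * lg (node I a w m)))"
  define A where "A = (\<lambda>m. m(x := 0 :: nat)) ` indices J"
  define B where "B = (\<lambda>m. m(x := Suc (m x))) ` indices I"
  have AB: "indices I = A \<union> B"
    using indices_insert_Un[OF I(2)] by (simp add: A_def B_def I(1))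
  have "f summable_on indices I"
    unfolding f_def using s by (rule barnes_sum_summable)
  then have "f summable_on A" "f summable_on B"
    by (auto intro: summable_on_subset_banach simp: AB)
  moreover have "A \<inter> B = {}"
    by (auto simp: A_def B_def dest: fun_cong[of _ _ x])
  ultimately have "infsum f (indices I) = infsum f A + infsum f B"
    unfolding AB by (rule infsum_Un_disjoint)
  moreover have "inj_on (\<lambda>m. m(x := 0 :: nat)) (indices J)"
  proof (rule inj_onI)
    fix m m' :: "'i \<Rightarrow> nat" assume m: "m \<in> indices J" "m' \<in> indices J" "m(x := 0) = m'(x := 0)"
    have "m x = m' x"
      using m(1,2) I(2) by (simp add: PiE_def extensional_def)
    then show "m = m'"
      using m(3) by (metis fun_upd_triv fun_upd_upd)
  qed
  then have "infsum f A = barnes_sum lg J a w s"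
    unfolding A_def by (simp add: infsum_reindex o_def f_def I node_insert_0 barnes_sum_def)
  moreover have "inj_on (\<lambda>m. m(x := Suc (m x))) (indices I)"
  proof (rule inj_onI)
    fix m m' :: "'i \<Rightarrow> nat" assume m: "m(x := Suc (m x)) = m'(x := Suc (m' x))"
    then have "m x = m' x"
      by (metis fun_upd_same nat.inject)
    with m show "m = m'"
      by (metis fun_upd_triv fun_upd_upd)
  qed
  then have "infsum f B = (\<Sum>\<^sub>\<infinity>m\<in>indices I. exp (- s * lg (node I a w m + w x)))"
    unfolding B_def using finite_I I by (simp add: infsum_reindex o_def f_def node_Suc)
  ultimately show ?thesis
    by (simp add: barnes_sum_def f_def)
qed

text \<open>
  Expand every term of the shifted series by the binomial series and compare with the unshifted one.
  The contributions of order \<open>k = 0\<close> cancel, and the one of order \<open>k = 1\<close> is isolated on the left.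
  Every value of the series on the right, apart from the one with fewer periods, is taken farther to
  the right than \<open>s + 1\<close>.
\<close>
lemma barnes_sum_recurrence:
  assumes I: "I = insert x J" "x \<notin> J" and s: "Re s > card I"
  shows "s * w x * barnes_sum lg I a w (s + 1) =
    barnes_sum lg J a w s
    + (\<Sum>k=2..Suc N. (-1) ^ k * pochhammer s k / fact k * w x ^ k * barnes_sum lg I a w (s + of_nat k))
    + remainder_sum (Suc N) (w x) s"
proof -
  define Z where "Z = barnes_sum lg I a w"
  define c where "c = (\<lambda>k. (-1) ^ k * pochhammer s k / fact k * w x ^ k)"
  define E where "E = (\<lambda>k m. exp (- (s + of_nat k) * lg (node I a w m)))"
  have wx: "w x \<in> H" using w_in_H I by auto
  have "((\<lambda>m. taylor_remainder (Suc N) (w x) (node I a w m) s) has_sum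
      remainder_sum (Suc N) (w x) s) (indices I)"
    unfolding remainder_sum_def
    using s by (intro has_sum_infsum remainder_sum_summable[OF wx]) simp
  moreover have "((\<lambda>m. \<Sum>k\<le>Suc N. c k * E k m) has_sum (\<Sum>k\<le>Suc N. c k * Z (s + of_nat k))) (indices I)"
    unfolding Z_def barnes_sum_def E_def using s
    by (intro has_sum_sum_finite has_sum_cmult_right has_sum_infsum barnes_sum_summable) auto
  ultimately have "((\<lambda>m. taylor_remainder (Suc N) (w x) (node I a w m) s + (\<Sum>k\<le>Suc N. c k * E k m))
      has_sum (remainder_sum (Suc N) (w x) s + (\<Sum>k\<le>Suc N. c k * Z (s + of_nat k)))) (indices I)"
    by (rule has_sum_add)
  then have "((\<lambda>m. exp (- s * lg (node I a w m + w x))) has_sum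
      (remainder_sum (Suc N) (w x) s + (\<Sum>k\<le>Suc N. c k * Z (s + of_nat k)))) (indices I)"
    by (simp only: taylor_remainder_def c_def E_def diff_add_cancel)
  then have "Z s = barnes_sum lg J a w s +
      (remainder_sum (Suc N) (w x) s + (\<Sum>k\<le>Suc N. c k * Z (s + of_nat k)))"
    using barnes_sum_split[OF I s] by (simp add: infsumI Z_def)
  moreover have "(\<Sum>k\<le>Suc N. c k * Z (s + of_nat k)) =
      Z s - s * w x * Z (s + 1) + (\<Sum>k=2..Suc N. c k * Z (s + of_nat k))"
  proof -
    have "{..Suc N} = insert 0 (insert 1 {2..Suc N})" by auto
    then show ?thesis by (simp add: c_def)
  qed
  ultimately have "s * w x * Z (s + 1) =
      barnes_sum lg J a w s + (\<Sum>k=2..Suc N. c k * Z (s + of_nat k)) + remainder_sum (Suc N) (w x) s"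
    by algebra
  then show ?thesis
    by (simp only: c_def Z_def)
qed

end

section \<open>Analytic continuation\<close>

lemma connected_right_half_plane: "connected (right_half_plane \<alpha>)"
  by (intro convex_connected convex_halfspace_Re_gt)

lemma right_half_plane_nonempty: "right_half_plane \<alpha> \<noteq> {}"
  by (auto intro!: exI[of _ "of_real (\<alpha> + 1)"])

lemma eq_on_right_half_plane:
  assumes "f holomorphic_on right_half_plane \<alpha>" "g holomorphic_on right_half_plane \<alpha>"
    and eq: "\<And>s. Re s > \<beta> \<Longrightarrow> f s = g s" and "Re s > \<alpha>"
  shows "f s = g s"
proof (rule analytic_continuation_open[of "right_half_plane (max \<alpha> \<beta>)" "right_half_plane \<alpha>" f g])
  show "f z = g z" if "z \<in> right_half_plane (max \<alpha> \<beta>)" for z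
    using that by (intro eq) auto
  show "right_half_plane (max \<alpha> \<beta>) \<subseteq> right_half_plane \<alpha>" "s \<in> right_half_plane \<alpha>"
    using \<open>Re s > \<alpha>\<close> by auto
qed (fact assms open_right_half_plane connected_right_half_plane right_half_plane_nonempty)+

text \<open>
  Extensions to wider and wider half-planes agree wherever they are both defined, by the identity
  theorem, and so fit together.
\<close>
lemma entire_extension:
  fixes f :: "complex \<Rightarrow> complex"
  assumes ext: "\<And>N. \<exists>g. g holomorphic_on right_half_plane (\<alpha> - real N) \<and> (\<forall>s. Re s > \<beta> \<longrightarrow> g s = f s)"
  shows "\<exists>G. G holomorphic_on UNIV \<and> (\<forall>s. Re s > \<beta> \<longrightarrow> G s = f s)"
proof -
  from ext obtain g where hol: "\<And>N. g N holomorphic_on right_half_plane (\<alpha> - real N)"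
    and eq: "\<And>N s. Re s > \<beta> \<Longrightarrow> g N s = f s"
    by metis
  have coherent: "g N s = g M s" if "N \<le> M" "Re s > \<alpha> - real N" for N M s
  proof (rule eq_on_right_half_plane[OF hol _ _ that(2)])
    show "g M holomorphic_on right_half_plane (\<alpha> - real N)"
      using that(1) by (intro holomorphic_on_subset[OF hol[of M]]) auto
    show "g N z = g M z" if "Re z > \<beta>" for z
      using that by (simp add: eq)
  qed
  \<comment> \<open>Any half-plane that contains \<open>s\<close> gives the same value.\<close>
  define G where "G = (\<lambda>s. g (LEAST N. Re s > \<alpha> - real N) s)"
  have G: "G s = g N s" if "Re s > \<alpha> - real N" for N s
    unfolding G_def using that LeastI[of "\<lambda>N. Re s > \<alpha> - real N" N]
    by (intro coherent Least_le) auto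
  have "G holomorphic_on UNIV"
    unfolding holomorphic_on_open[OF open_UNIV]
  proof
    fix s
    obtain N where N: "real N > \<alpha> - Re s"
      using reals_Archimedean2 by blast
    have "G holomorphic_on right_half_plane (\<alpha> - real N)"
      using hol[of N] by (rule holomorphic_transform) (simp add: G)
    then show "\<exists>f'. (G has_field_derivative f') (at s)"
      using N by (auto simp: holomorphic_on_open[OF open_right_half_plane])
  qed
  moreover have "G s = f s" if "Re s > \<beta>" for s
    unfolding G_def by (rule eq[OF that])
  ultimately show ?thesis by blast
qed


context barnes
begin

text \<open>
  The recurrence, multiplied by \<open>(s - 1) \<dots> (s - (r - 1))\<close> and read at \<open>s - 1\<close>, expresses the product
  of the Barnes series with \<open>(s - 1) \<dots> (s - r)\<close> through its own values at least one unit to the right,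
  the entire function for one period less, and the series of remainders. The point is that all
  coefficients are polynomials in \<open>s\<close>: the zeros of the binomial coefficient
  at \<open>0, -1, \<dots>, - (k - 1)\<close> supply exactly the factors that turn the product
  \<open>(s - 1) \<dots> (s - (r - 1))\<close> into a multiple of \<open>(s + k - 1) \<dots> (s + k - r)\<close>.

  Agreement with the series is asked for \<open>Re s > r + 1\<close> only, because the recurrence at \<open>s - 1\<close> needs
  \<open>Re (s - 1) > r\<close>.
\<close>
lemma continuation_step:
  assumes I: "I = insert x J" "x \<notin> J"
    and G': "G' holomorphic_on UNIV"
      "\<And>s. Re s > card J \<Longrightarrow> G' s = pochhammer (s - of_nat (card J)) (card J) * barnes_sum lg J a w s"
    and g: "g holomorphic_on right_half_plane (real (card I) - real N)"
      "\<And>s. Re s > card I + 1 \<Longrightarrow> g s = pochhammer (s - of_nat (card I)) (card I) * barnes_sum lg I a w s"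
  shows "\<exists>h. h holomorphic_on right_half_plane (real (card I) - real (Suc N)) \<and>
    (\<forall>s. Re s > card I + 1 \<longrightarrow> h s = pochhammer (s - of_nat (card I)) (card I) * barnes_sum lg I a w s)"
proof -
  define q where "q = card J"
  have r: "card I = Suc q"
    using I finite_I by (simp add: q_def)
  have wx: "w x \<in> H" using w_in_H I by auto
  define Z where "Z = barnes_sum lg I a w"
  define h where "h = (\<lambda>s. inverse (w x) * (G' (s - 1)
    + (\<Sum>k=2..Suc N. (-1) ^ k / fact k * w x ^ k *
         pochhammer (s - 1 - of_nat q) (k - 1) * g (s - 1 + of_nat k))
    + pochhammer (s - 1 - of_nat q) q * remainder_sum (Suc N) (w x) (s - 1)))"
  have "h holomorphic_on right_half_plane (real (card I) - real (Suc N))"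
  proof -
    have 1: "(\<lambda>s. G' (s - 1)) holomorphic_on A" for A
      using holomorphic_on_compose_gen[OF _ G'(1), of "\<lambda>s. s - 1" A]
      by (simp add: o_def holomorphic_intros)
    have 2: "(\<lambda>s. g (s - 1 + of_nat k)) holomorphic_on right_half_plane (real (card I) - real (Suc N))"
      if "k \<ge> 2" for k
    proof -
      have "(\<lambda>s. s - 1 + of_nat k) ` right_half_plane (real (card I) - real (Suc N))
          \<subseteq> right_half_plane (real (card I) - real N)"
        using that by auto
      then show ?thesis
        using holomorphic_on_compose_gen[OF _ g(1), of "\<lambda>s. s - 1 + of_nat k"]
        by (simp add: o_def holomorphic_intros)
    qed
    have 3: "(\<lambda>s. remainder_sum (Suc N) (w x) (s - 1)) holomorphic_on
        right_half_plane (real (card I) - real (Suc N))"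
    proof -
      have "(\<lambda>s. s - 1) ` right_half_plane (real (card I) - real (Suc N))
          \<subseteq> right_half_plane (real (card I) - real (Suc (Suc N)))"
        by auto
      then show ?thesis
        using holomorphic_on_compose_gen[OF _ remainder_sum_holomorphic[OF wx], of "\<lambda>s. s - 1"]
        by (simp add: o_def holomorphic_intros)
    qed
    show ?thesis
      unfolding h_def by (intro holomorphic_intros 1 2 3) auto
  qed
  moreover have "h s = pochhammer (s - of_nat (card I)) (card I) * barnes_sum lg I a w s"
    if s: "Re s > card I + 1" for s
  proof -
    define t where "t = s - 1"
    have t: "Re t > card I" using s by (simp add: t_def)
    define P where "P = pochhammer (t - of_nat q) q"
    have G't: "G' t = P * barnes_sum lg J a w t"
      using G'(2)[of t] t r by (simp add: P_def q_def)
    \<comment> \<open>Both products are the rising factorial from \<open>t - q\<close> to \<open>t + k - 1\<close>, cut at two different places.\<close>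
    have term_eq: "pochhammer (t - of_nat q) (k - 1) * g (t + of_nat k) = P * pochhammer t k * Z (t + of_nat k)"
      if "k \<in> {2..Suc N}" for k
    proof -
      have k: "k \<ge> 2" using that by simp
      have g_eq: "g (t + of_nat k) = pochhammer (t + of_nat k - of_nat (Suc q)) (Suc q) * Z (t + of_nat k)"
        using g(2)[of "t + of_nat k"] t k r by (simp add: Z_def)
      have arg: "t + of_nat k - of_nat (Suc q) = t - of_nat q + of_nat (k - 1)"
        using k by (simp add: of_nat_diff)
      have prod_eq: "pochhammer (t - of_nat q) (k - 1) * pochhammer (t - of_nat q + of_nat (k - 1)) (Suc q)
          = pochhammer (t - of_nat q) q * pochhammer (t - of_nat q + of_nat q) k"
        using k by (simp only: pochhammer_product'[symmetric]) (simp add: add.commute)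
      have "pochhammer (t - of_nat q) (k - 1) * g (t + of_nat k) =
          (pochhammer (t - of_nat q) (k - 1) * pochhammer (t - of_nat q + of_nat (k - 1)) (Suc q))
            * Z (t + of_nat k)"
        by (simp only: g_eq arg mult.assoc)
      also have "\<dots> = P * pochhammer t k * Z (t + of_nat k)"
        by (simp only: prod_eq P_def diff_add_cancel)
      finally show ?thesis .
    qed
    have "h s = inverse (w x) * (G' t
        + (\<Sum>k=2..Suc N. (-1) ^ k / fact k * w x ^ k *
             (pochhammer (t - of_nat q) (k - 1) * g (t + of_nat k)))
        + P * remainder_sum (Suc N) (w x) t)"
      by (simp only: h_def t_def P_def mult.assoc)
    also have "\<dots> = inverse (w x) * (G' t
        + (\<Sum>k=2..Suc N. (-1) ^ k / fact k * w x ^ k * (P * pochhammer t k * Z (t + of_nat k)))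
        + P * remainder_sum (Suc N) (w x) t)"
      by (simp only: term_eq cong: sum.cong)
    also have "\<dots> = inverse (w x) * (P * (barnes_sum lg J a w t
        + (\<Sum>k=2..Suc N. (-1) ^ k * pochhammer t k / fact k * w x ^ k * Z (t + of_nat k))
        + remainder_sum (Suc N) (w x) t))"
      by (simp add: G't distrib_left sum_distrib_left mult_ac del: sum.cl_ivl_Suc)
    also have "\<dots> = inverse (w x) * (P * (t * w x * Z (t + 1)))"
      using barnes_sum_recurrence[OF I t, of N] by (simp only: Z_def)
    also have "\<dots> = P * t * Z s"
      using zero_notin_H[OF wx] by (simp add: t_def)
    also have "P * t = pochhammer (s - of_nat (card I)) (card I)"
    proof -
      have "s - of_nat (Suc q) = t - of_nat q"
        by (simp add: t_def)
      then show ?thesis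
        by (simp only: P_def r pochhammer_Suc diff_add_cancel)
    qed
    finally show ?thesis by (simp only: Z_def)
  qed
  ultimately show ?thesis by blast
qed

end

context half_plane_log
begin

text \<open>
  Induction on the number of periods, and for each number induction on the width of the half-plane.
  It starts from the empty set of periods, whose Barnes series is the entire function \<open>a\<^sup>-\<^sup>s\<close>.
\<close>
lemma barnes_sum_continuation:
  assumes "finite I" "a \<in> H" "\<And>i. i \<in> I \<Longrightarrow> w i \<in> H"
  shows "\<exists>G. G holomorphic_on UNIV \<and>
    (\<forall>s. Re s > card I \<longrightarrow> G s = pochhammer (s - of_nat (card I)) (card I) * barnes_sum lg I a w s)"
  using assms(1,3)
proof (induction I rule: finite_induct)
  case empty
  have "(\<lambda>s. exp (- s * lg a)) holomorphic_on UNIV"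
    by (intro holomorphic_intros)
  then show ?case
    by (intro exI[of _ "\<lambda>s. exp (- s * lg a)"]) (simp add: barnes_sum_def node_def)
next
  case (insert x J)
  define I where "I = insert x J"
  interpret barnes \<phi> lg I a w
    using insert.hyps insert.prems assms(2) by unfold_locales (auto simp: I_def)
  define f where "f = (\<lambda>s. pochhammer (s - of_nat (card I)) (card I) * barnes_sum lg I a w s)"
  have hol_f: "f holomorphic_on right_half_plane (card I)"
    unfolding f_def by (intro holomorphic_intros barnes_sum_holomorphic)
  obtain G' where G': "G' holomorphic_on UNIV"
    "\<And>s. Re s > card J \<Longrightarrow> G' s = pochhammer (s - of_nat (card J)) (card J) * barnes_sum lg J a w s"
    using insert by auto
  have "\<exists>g. g holomorphic_on right_half_plane (real (card I) - real N) \<and>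
      (\<forall>s. Re s > card I + 1 \<longrightarrow> g s = f s)" for N
  proof (induction N)
    case 0
    show ?case using hol_f by (intro exI[of _ f]) simp
  next
    case (Suc N)
    then obtain g where "g holomorphic_on right_half_plane (real (card I) - real N)"
      "\<And>s. Re s > card I + 1 \<Longrightarrow> g s = f s" by auto
    then show ?case
      using continuation_step[OF I_def insert.hyps(2) G'] unfolding f_def by blast
  qed
  then obtain G where G: "G holomorphic_on UNIV" "\<And>s. Re s > card I + 1 \<Longrightarrow> G s = f s"
    using entire_extension[of "real (card I)" "card I + 1" f] by blast
  have "G s = f s" if "Re s > card I" for s
    using holomorphic_on_subset[OF G(1)] hol_f G(2) that by (rule eq_on_right_half_plane) auto
  with G(1) show ?case
    unfolding f_def I_def by blast
qed

end

section \<open>Partial fractions, meromorphic functions and Laurent expansions\<close>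

text \<open>
  Dividing by one more factor \<open>s - p x\<close> only requires to subtract from the entire part its value at
  \<open>p x\<close>, and to split each product of two simple poles.
\<close>
lemma partial_fractions:
  fixes p :: "'i \<Rightarrow> complex"
  assumes "finite A" "inj_on p A" "G holomorphic_on UNIV"
  shows "\<exists>E c. E holomorphic_on UNIV \<and>
    (\<forall>s. s \<notin> p ` A \<longrightarrow> G s / (\<Prod>q\<in>A. s - p q) = E s + (\<Sum>q\<in>A. c q / (s - p q)))"
  using assms(1,2)
proof (induction A rule: finite_induct)
  case empty
  then show ?case using assms(3) by (intro exI[of _ G]) simp
next
  case (insert x A)
  then obtain E c where E: "E holomorphic_on UNIV"
    and eq: "\<And>s. s \<notin> p ` A \<Longrightarrow> G s / (\<Prod>q\<in>A. s - p q) = E s + (\<Sum>q\<in>A. c q / (s - p q))"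
    by auto
  \<comment> \<open>An old coefficient is divided by \<open>p q - p x\<close>; the new one collects \<open>E (p x)\<close> and what the
    splitting of the old fractions leaves at \<open>p x\<close>.\<close>
  define E' where "E' = (\<lambda>s. if s = p x then deriv E (p x) else (E s - E (p x)) / (s - p x))"
  define c' where "c' = (\<lambda>q. c q / (p q - p x))(x := E (p x) + (\<Sum>q\<in>A. c q / (p x - p q)))"
  have "E' holomorphic_on UNIV"
    unfolding E'_def using E by (intro pole_lemma_open) auto
  moreover have "G s / (\<Prod>q\<in>insert x A. s - p q) = E' s + (\<Sum>q\<in>insert x A. c' q / (s - p q))"
    if s: "s \<notin> p ` insert x A" for s
  proof -
    have sx: "s - p x \<noteq> 0" using s by auto
    have split: "c q / (s - p q) / (s - p x) =
        c q / (p x - p q) / (s - p x) + c q / (p q - p x) / (s - p q)" if "q \<in> A" for q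
    proof -
      have "s - p q \<noteq> 0" "p q - p x \<noteq> 0" "p x - p q \<noteq> 0"
        using s that insert.hyps(2) insert.prems by (auto simp: inj_on_def)
      with sx show ?thesis
        by (simp add: divide_simps) (simp add: algebra_simps)
    qed
    have "G s / (\<Prod>q\<in>insert x A. s - p q) = (G s / (\<Prod>q\<in>A. s - p q)) / (s - p x)"
      using insert.hyps by (simp add: mult.commute)
    also have "\<dots> = E s / (s - p x) + (\<Sum>q\<in>A. c q / (s - p q) / (s - p x))"
      using s eq[of s] by (simp add: add_divide_distrib sum_divide_distrib)
    also have "(\<Sum>q\<in>A. c q / (s - p q) / (s - p x)) =
        (\<Sum>q\<in>A. c q / (p x - p q)) / (s - p x) + (\<Sum>q\<in>A. c q / (p q - p x) / (s - p q))"
      by (simp only: split sum.distrib sum_divide_distrib cong: sum.cong)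
    also have "(\<Sum>q\<in>A. c q / (p q - p x) / (s - p q)) = (\<Sum>q\<in>A. c' q / (s - p q))"
      using insert.hyps by (intro sum.cong) (auto simp: c'_def)
    finally show ?thesis
      using insert.hyps sx s by (simp add: E'_def c'_def add_divide_distrib diff_divide_distrib)
  qed
  ultimately show ?case by blast
qed

lemma pochhammer_eq_prod_roots:
  fixes s :: "'a :: comm_ring_1"
  shows "pochhammer (s - of_nat r) r = (\<Prod>q=1..r. s - of_nat q)"
  unfolding pochhammer_prod_rev by (intro prod.cong) (auto simp: of_nat_diff)

lemma nicely_meromorphic_remove_sings:
  assumes "f nicely_meromorphic_on A" "z \<in> A"
  shows "remove_sings f z = f z"
  using assms unfolding nicely_meromorphic_on_def by (metis remove_sings_at_pole remove_sings_eqI)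

text \<open>
  The identity theorem for nicely meromorphic functions. Their values, also those at poles, are
  determined by the behaviour in punctured neighbourhoods, so that equality near a point spreads to
  equality everywhere.
\<close>
lemma nicely_meromorphic_eqI:
  assumes f: "f nicely_meromorphic_on UNIV" and g: "g nicely_meromorphic_on UNIV"
    and eq: "eventually (\<lambda>s. f s = g s) (at z0)"
  shows "f = g"
proof
  fix z
  have mero: "(\<lambda>s. f s - g s) meromorphic_on UNIV"
    using f g unfolding nicely_meromorphic_on_def by (intro meromorphic_intros) auto
  then have iso: "isolated_singularity_at (\<lambda>s. f s - g s) z" for z
    using meromorphic_on_isolated_singularity by (metis UNIV_I meromorphic_on_subset subset_UNIV)
  have "eventually (\<lambda>s. remove_sings (\<lambda>s. f s - g s) s = 0) (at z0)"
    using eventually_remove_sings_eq_at[OF iso] eq by eventually_elim simp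
  then have "frequently (\<lambda>s. remove_sings (\<lambda>s. f s - g s) s = 0) (at z0)"
    by (rule eventually_frequently[rotated]) simp
  then have 0: "remove_sings (\<lambda>s. f s - g s) s = 0" for s
    using remove_sings_nicely_meromorphic[OF mero] frequently_eq_meromorphic_imp_constant by blast
  have "eventually (\<lambda>s. f s = g s) (at z)"
    using eventually_remove_sings_eq_at[OF iso, of z] by eventually_elim (simp add: 0)
  then have "remove_sings f z = remove_sings g z"
    by (intro remove_sings_cong) auto
  then show "f z = g z"
    using f g by (simp add: nicely_meromorphic_remove_sings)
qed

lemma fps_nth_inverse_const_plus_X:
  fixes d :: "'a :: field"
  assumes "d \<noteq> 0"
  shows "fps_nth (inverse (fps_const d + fps_X)) k = (-1) ^ k / d ^ (k + 1)"
proof -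
  have "(fps_const d + fps_X) * Abs_fps (\<lambda>k. (-1) ^ k / d ^ (k + 1)) = 1"
  proof (rule fps_ext)
    fix n
    show "fps_nth ((fps_const d + fps_X) * Abs_fps (\<lambda>k. (-1) ^ k / d ^ (k + 1))) n = fps_nth 1 n"
      using assms by (cases n) (auto simp: distrib_right)
  qed
  then have "inverse (fps_const d + fps_X) = Abs_fps (\<lambda>k. (-1) ^ k / d ^ (k + 1))"
    by (rule fps_inverse_unique)
  then show ?thesis by simp
qed

lemma eventually_at_not_in_finite:
  fixes z :: "'a :: t1_space"
  assumes "finite A"
  shows "eventually (\<lambda>s. s \<notin> A) (at z)"
proof -
  have "eventually (\<lambda>s. s \<in> - (A - {z}) - {z}) (at z)"
    by (intro eventually_at_in_open open_Compl finite_imp_closed) (use assms in auto)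
  then show ?thesis by eventually_elim auto
qed

lemma has_laurent_expansion_simple_poles:
  fixes p :: "'i \<Rightarrow> complex"
  assumes A: "finite A" "inj_on p A" "j \<in> A" and E: "E holomorphic_on UNIV"
    and Z: "\<And>s. s \<notin> p ` A \<Longrightarrow> Z s = E s + (\<Sum>q\<in>A. c q / (s - p q))"
  shows "(\<lambda>z. Z (p j + z)) has_laurent_expansion fls_const (c j) * fls_X_inv +
    fps_to_fls (fps_expansion E (p j) +
      (\<Sum>q\<in>A - {j}. fps_const (c q) * inverse (fps_const (p j - p q) + fps_X)))"
    (is "_ has_laurent_expansion ?L")
proof -
  have E': "(\<lambda>z. E (p j + z)) has_fps_expansion fps_expansion E (p j)"
    using E by (intro analytic_at_imp_has_fps_expansion) (simp add: holomorphic_on_imp_analytic_at)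
  have nz: "fps_nth (fps_const (p j - p q) + fps_X) 0 \<noteq> 0" if "q \<in> A - {j}" for q
    using A that by (auto simp: inj_on_def)
  have "(\<lambda>z. E (p j + z) + (\<Sum>q\<in>A - {j}. c q * inverse (p j - p q + z))) has_fps_expansion
      (fps_expansion E (p j) + (\<Sum>q\<in>A - {j}. fps_const (c q) * inverse (fps_const (p j - p q) + fps_X)))"
    using nz by (intro fps_expansion_intros E') auto
  from has_laurent_expansion_fps[OF this]
  have "(\<lambda>z. c j * inverse z + (E (p j + z) + (\<Sum>q\<in>A - {j}. c q * inverse (p j - p q + z))))
      has_laurent_expansion ?L"
    by (intro laurent_expansion_intros)
  also have "?this \<longleftrightarrow> ?thesis"
  proof (rule has_laurent_expansion_cong)
    have "eventually (\<lambda>s. s \<notin> p ` A) (at (p j))"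
      using A by (intro eventually_at_not_in_finite) auto
    then have "eventually (\<lambda>z. p j + z \<notin> p ` A) (at 0)"
      by (simp add: at_to_0' eventually_filtermap add.commute)
    then show "eventually (\<lambda>z. c j * inverse z + (E (p j + z) +
        (\<Sum>q\<in>A - {j}. c q * inverse (p j - p q + z))) = Z (p j + z)) (at 0)"
      by eventually_elim
        (use A in \<open>simp add: Z sum.remove[of A j] divide_inverse algebra_simps\<close>)
  qed simp
  finally show ?thesis .
qed

lemma max_norm_on_circle_ge:
  assumes "continuous_on (sphere c R) f" and s: "s \<in> sphere c R"
  shows "norm (f s) \<le> max_norm_on_circle f c R"
proof -
  have "compact ((\<lambda>s. norm (f s)) ` sphere c R)"
    using assms(1) by (intro compact_continuous_image continuous_intros) auto
  moreover have "(\<lambda>s. norm (f s)) ` sphere c R \<noteq> {}"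
    using s by auto
  ultimately obtain x where "x \<in> (\<lambda>s. norm (f s)) ` sphere c R"
    "\<And>y. y \<in> (\<lambda>s. norm (f s)) ` sphere c R \<Longrightarrow> y \<le> x"
    by (meson compact_attains_sup)
  then have "max_norm_on_circle f c R = x"
    unfolding max_norm_on_circle_def by (intro Greatest_equality)
  then show ?thesis
    using s \<open>\<And>y. y \<in> _ \<Longrightarrow> y \<le> x\<close> by auto
qed

section \<open>The Laurent coefficients of the Barnes zeta function\<close>

lemma barnes_series_eq_barnes_sum: "barnes_series lg r a w = barnes_sum lg {1..r} a w"
  by (simp add: barnes_series_def[abs_def] barnes_sum_def[abs_def] node_def)

text \<open>
  Here the definite description behind the Barnes zeta function is resolved: the entire continuation
  of \<open>(s - 1) \<dots> (s - r)\<close> times the series, divided by that polynomial, provides a nicely meromorphic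
  candidate, and there is no other.
\<close>
lemma barnes_zeta_simple_poles:
  assumes "holomorphic_log_on lg (half_plane \<phi>)" "a \<in> half_plane \<phi>"
    and "\<And>i. i \<in> {1..r} \<Longrightarrow> w i \<in> half_plane \<phi>"
  shows "\<exists>E c. E holomorphic_on UNIV \<and> (\<forall>s. s \<notin> of_nat ` {1..r} \<longrightarrow>
    barnes_zeta lg r a w s = E s + (\<Sum>q=1..r. c q / (s - of_nat q)))"
proof -
  interpret half_plane_log \<phi> lg
    using assms(1) by unfold_locales
  obtain G where G: "G holomorphic_on UNIV"
    "\<And>s. Re s > r \<Longrightarrow> G s = pochhammer (s - of_nat r) r * barnes_series lg r a w s"
    using barnes_sum_continuation[of "{1..r}" a w] assms(2,3) by (auto simp: barnes_series_eq_barnes_sum)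
  obtain E c where E: "E holomorphic_on UNIV" and eq: "\<And>s. s \<notin> of_nat ` {1..r} \<Longrightarrow>
      G s / (\<Prod>q=1..r. s - of_nat q) = E s + (\<Sum>q=1..r. c q / (s - of_nat q))"
    using partial_fractions[OF _ _ G(1), of "{1..r}" of_nat] by (auto simp: inj_on_def)
  define F where "F = (\<lambda>s. E s + (\<Sum>q=1..r. c q / (s - of_nat q)))"
  have poles: "closed (of_nat ` {1..r} :: complex set)"
    by (intro finite_imp_closed) auto
  have hol_F: "F holomorphic_on - (of_nat ` {1..r})"
    unfolding F_def using E by (intro holomorphic_intros) (auto intro: holomorphic_on_subset)
  have "E meromorphic_on UNIV"
    using E by (intro analytic_on_imp_meromorphic_on) (simp add: analytic_on_open)
  then have "F meromorphic_on UNIV"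
    unfolding F_def by (intro meromorphic_intros)
  define Z where "Z = remove_sings F"
  have nice: "Z nicely_meromorphic_on UNIV"
    unfolding Z_def using \<open>F meromorphic_on UNIV\<close> by (rule remove_sings_nicely_meromorphic)
  have Z_F: "Z s = F s" if "s \<notin> of_nat ` {1..r}" for s
  proof -
    have "F analytic_on {s}"
      using hol_F poles that by (intro holomorphic_on_imp_analytic_at[OF hol_F]) auto
    then show ?thesis
      by (simp add: Z_def)
  qed
  have Z_series: "Z s = barnes_series lg r a w s" if s: "Re s > r" for s
  proof -
    have notin: "s \<notin> of_nat ` {1..r}" using s by auto
    have "(\<Prod>q=1..r. s - of_nat q) \<noteq> 0"
      using notin by auto
    then show ?thesis
      using eq[OF notin] Z_F[OF notin] G(2)[OF s]
      by (simp add: F_def pochhammer_eq_prod_roots)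
  qed
  have "barnes_zeta lg r a w = Z"
    unfolding barnes_zeta_def
  proof (rule the_equality)
    show "Z nicely_meromorphic_on UNIV \<and> (\<forall>s. Re s > real r \<longrightarrow> Z s = barnes_series lg r a w s)"
      using nice Z_series by auto
  next
    fix Y assume Y: "Y nicely_meromorphic_on UNIV \<and> (\<forall>s. Re s > real r \<longrightarrow> Y s = barnes_series lg r a w s)"
    have "eventually (\<lambda>s. s \<in> right_half_plane r) (at (of_nat (Suc r)))"
      by (intro eventually_at_in_open' open_right_half_plane) auto
    then have "eventually (\<lambda>s. Y s = Z s) (at (of_nat (Suc r)))"
      by eventually_elim (use Y Z_series in auto)
    then show "Y = Z"
      using Y nice nicely_meromorphic_eqI by blast
  qed
  then show ?thesis
    using E Z_F unfolding F_def by auto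
qed

theorem theorem3p1:
  fixes r :: nat and \<phi> :: real and lg :: "complex \<Rightarrow> complex"
    and a :: complex and w :: "nat \<Rightarrow> complex"
  assumes "r \<ge> 2"
    and "- pi < \<phi>" and "\<phi> < pi"
    and "holomorphic_log_on lg (half_plane \<phi>)"
    and "a \<in> half_plane \<phi>"
    and "\<forall>i\<in>{1..r}. w i \<in> half_plane \<phi>"
  shows "\<forall>j\<in>{1..r}. \<forall>k.
     barnes_gamma lg r a w k j =
       (-1) ^ k * (\<Sum>q\<in>{1..<j}. barnes_residue lg r a w q / (of_nat j - of_nat q) ^ (k + 1))
       - (\<Sum>q\<in>{j<..r}. barnes_residue lg r a w q / (of_nat q - of_nat j) ^ (k + 1))
       + (deriv ^^ k) (barnes_entire lg r a w) (of_nat j) / fact k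
     \<and> (\<forall>R>0.
       norm (barnes_gamma lg r a w k j
             - (-1) ^ k * (\<Sum>q\<in>{1..<j}. barnes_residue lg r a w q / (of_nat j - of_nat q) ^ (k + 1))
             + (\<Sum>q\<in>{j<..r}. barnes_residue lg r a w q / (of_nat q - of_nat j) ^ (k + 1)))
       \<le> max_norm_on_circle (barnes_entire lg r a w) (of_nat j) R / R ^ k)"
proof -
  define Z where "Z = barnes_zeta lg r a w"
  obtain E c where E: "E holomorphic_on UNIV" and Z: "\<And>s. s \<notin> of_nat ` {1..r} \<Longrightarrow>
      Z s = E s + (\<Sum>q=1..r. c q / (s - of_nat q))"
    using barnes_zeta_simple_poles[of lg \<phi> a r w] assms unfolding Z_def by blast
  have laurent: "(\<lambda>z. Z (of_nat j + z)) has_laurent_expansion fls_const (c j) * fls_X_inv +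
      fps_to_fls (fps_expansion E (of_nat j) +
        (\<Sum>q\<in>{1..r} - {j}. fps_const (c q) * inverse (fps_const (of_nat j - of_nat q) + fps_X)))"
    if "j \<in> {1..r}" for j
    using that E Z by (intro has_laurent_expansion_simple_poles) (auto simp: inj_on_def)
  have residue: "barnes_residue lg r a w j = c j" if "j \<in> {1..r}" for j
    unfolding barnes_residue_def Z_def[symmetric]
    by (subst has_laurent_expansion_residue[OF laurent[OF that]]) simp
  \<comment> \<open>Both functions agree off the finitely many poles, and this determines what remains after the
    removal of singularities.\<close>
  have entire: "barnes_entire lg r a w = E"
  proof
    fix z
    have "barnes_entire lg r a w z = remove_sings E z"
      unfolding barnes_entire_def Z_def[symmetric]
    proof (rule remove_sings_cong)
      have "eventually (\<lambda>s :: complex. s \<notin> of_nat ` {1..r}) (at z)"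
        by (intro eventually_at_not_in_finite) auto
      then show "eventually (\<lambda>s. Z s - (\<Sum>q=1..r. barnes_residue lg r a w q / (s - of_nat q)) = E s) (at z)"
        by eventually_elim (simp add: Z residue)
    qed simp
    also have "\<dots> = E z"
      using E by (intro remove_sings_at_analytic holomorphic_on_imp_analytic_at) auto
    finally show "barnes_entire lg r a w z = E z" .
  qed
  show ?thesis
  proof (intro ballI allI conjI impI)
    fix j k assume j: "j \<in> {1..r}"
    let ?low = "\<Sum>q\<in>{1..<j}. barnes_residue lg r a w q / (of_nat j - of_nat q) ^ (k + 1)"
    let ?high = "\<Sum>q\<in>{j<..r}. barnes_residue lg r a w q / (of_nat q - of_nat j) ^ (k + 1)"
    let ?d = "(deriv ^^ k) (barnes_entire lg r a w) (of_nat j)"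
    note L = laurent[OF j]
    have "(\<lambda>z. Z (of_nat j + z)) has_laurent_expansion laurent_expansion Z (of_nat j)"
      using L by (intro not_essential_has_laurent_expansion)
        (auto intro: has_laurent_expansion_isolated has_laurent_expansion_not_essential)
    then have expansion: "laurent_expansion Z (of_nat j) = fls_const (c j) * fls_X_inv +
        fps_to_fls (fps_expansion E (of_nat j) +
          (\<Sum>q\<in>{1..r} - {j}. fps_const (c q) * inverse (fps_const (of_nat j - of_nat q) + fps_X)))"
      using L has_laurent_expansion_unique by blast
    have "barnes_gamma lg r a w k j = (deriv ^^ k) E (of_nat j) / fact k +
        (\<Sum>q\<in>{1..r} - {j}. c q * fps_nth (inverse (fps_const (of_nat j - of_nat q) + fps_X)) k)"
      unfolding barnes_gamma_def Z_def[symmetric] expansion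
      by (simp add: fps_sum_nth fps_expansion_def)
    also have "(\<Sum>q\<in>{1..r} - {j}. c q * fps_nth (inverse (fps_const (of_nat j - of_nat q) + fps_X)) k) =
        (\<Sum>q\<in>{1..r} - {j}. c q * ((-1) ^ k / (of_nat j - of_nat q) ^ (k + 1)))"
      by (intro sum.cong refl arg_cong2[of _ _ _ _ "(*)"] fps_nth_inverse_const_plus_X) auto
    also have "{1..r} - {j} = {1..<j} \<union> {j<..r}"
      using j by auto
    also have "(\<Sum>q\<in>{1..<j} \<union> {j<..r}. c q * ((-1) ^ k / (of_nat j - of_nat q) ^ (k + 1))) =
        (\<Sum>q\<in>{1..<j}. c q * ((-1) ^ k / (of_nat j - of_nat q) ^ (k + 1))) +
        (\<Sum>q\<in>{j<..r}. c q * ((-1) ^ k / (of_nat j - of_nat q) ^ (k + 1)))"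
      by (intro sum.union_disjoint) auto
    also have "(\<Sum>q\<in>{1..<j}. c q * ((-1) ^ k / (of_nat j - of_nat q) ^ (k + 1))) = (-1) ^ k * ?low"
      unfolding sum_distrib_left using j by (intro sum.cong) (auto simp: residue)
    also have "(\<Sum>q\<in>{j<..r}. c q * ((-1) ^ k / (of_nat j - of_nat q) ^ (k + 1))) = - ?high"
      unfolding sum_negf[symmetric]
    proof (intro sum.cong refl)
      fix q assume q: "q \<in> {j<..r}"
      have "(of_nat j - of_nat q :: complex) ^ (k + 1) = (- 1) ^ (k + 1) * (of_nat q - of_nat j) ^ (k + 1)"
        by (simp only: power_mult_distrib[symmetric] mult_minus1 minus_diff_eq)
      then show "c q * ((-1) ^ k / (of_nat j - of_nat q) ^ (k + 1)) =
          - (barnes_residue lg r a w q / (of_nat q - of_nat j) ^ (k + 1))"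
        using q j by (simp add: residue)
    qed
    finally show formula: "barnes_gamma lg r a w k j = (-1) ^ k * ?low - ?high + ?d / fact k"
      by (simp add: entire)
    fix R :: real assume R: "R > 0"
    have cont: "continuous_on A E" for A
      using E holomorphic_on_imp_continuous_on continuous_on_subset by blast
    have "norm ?d \<le> fact k * max_norm_on_circle E (of_nat j) R / R ^ k"
      unfolding entire using E R
      by (intro Cauchy_inequality cont max_norm_on_circle_ge)
        (auto intro: holomorphic_on_subset simp: dist_norm)
    then have "norm (?d / fact k) \<le> max_norm_on_circle E (of_nat j) R / R ^ k"
      by (simp add: norm_divide field_simps)
    then show "norm (barnes_gamma lg r a w k j - (-1) ^ k * ?low + ?high)
        \<le> max_norm_on_circle (barnes_entire lg r a w) (of_nat j) R / R ^ k"
      unfolding formula by (simp add: entire)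
  qed
qed

end
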